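(* Let $K\le n$ and let $\mathcal{D}\subseteq\mathcal{V}_{\mathrm{simple}}^K$ denote the set of pairs $(V,\vec\lambda)$ for which the matrix $V\in\mathbb{R}^{n\times K}$ has strictly fewer than $n$ zero-valued entries. Then EPNN is complete on $\mathcal{D}$: for any two non-isomorphic pairs $(V,\vec\lambda),(U,\vec\eta)\in\mathcal{D}$ there is $f\in\mathcal{F}_{\mathrm{EPNN}}$ with $f(V,\vec\lambda)\neq f(U,\vec\eta)$.
   Context: Notation. $S_n$ denotes the group of $n\times n$ permutation matrices; $S\in\{-1,1\}^K$ is identified with the $K\times K$ diagonal matrix with that diagonal. $\odot$ is the elementwise product. For $K\le n$, $$\mathcal{V}_{\mathrm{simple}}^K=\{(V,\vec\lambda)\in\mathbb{R}^{n\times K}\oplus\mathbb{R}^K : \lambda_1>\lambda_2>\dots>\lambda_K\}.$$ The columns of $V$ play the role of eigenvectors and $V_i\in\mathbb{R}^K$ denotes the $i$-th row of $V$. Two pairs $(V,\vec\lambda),(U,\vec\eta)$ are isomorphic if $\vec\lambda=\vec\eta$ and $U=PVS$ for some $P\in S_n$, $S\in\{-1,1\}^K$. EPNN. Given $(V,\vec\lambda)\in\mathcal{V}_{\mathrm{simple}}^K$, set $h_i^{(0)}=V_i\odot V_i$ for $i=1,\dots,n$, and iterate for $t=0,\dots,T-1$ $$h_i^{(t+1)}=\mathrm{UPDATE}_{(t)}\big(h_i^{(t)},\vec\lambda,\{(h_j^{(t)},V_i\odot V_j): j=1,\dots,n\}\big),$$ and output $f(V,\vec\lambda)=h_{\mathrm{global}}=\mathrm{READOUT}(\{h_i^{(T)}: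 i=1,\dots,n\})$, where $\{\cdot\}$ denotes multisets, $\mathrm{UPDATE}_{(t)}$ are arbitrary functions and $\mathrm{READOUT}$ is an arbitrary function with values in some $\mathbb{R}^m$. $\mathcal{F}_{\mathrm{EPNN}}$ is the collection of all functions $f$ obtained this way, over all $T$ and all choices of $\mathrm{UPDATE}_{(t)}$ and $\mathrm{READOUT}$; each such $f$ satisfies $f(V,\vec\lambda)=f(PVS,\vec\lambda)$ for all $P\in S_n$, $S\in\{-1,1\}^K$. *)

theory Defs
  imports
    "Jordan_Normal_Form.Matrix"
    "HOL-Combinatorics.Permutations"
    "HOL-Library.Multiset"
begin

text \<open>Indices run from \<open>0\<close>: rows of \<open>V\<close> over \<open>{..<n}\<close>, columns and eigenvalues over \<open>{..<K}\<close>.\<close>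

definition V_simple :: "nat \<Rightarrow> nat \<Rightarrow> (real mat \<times> real vec) set" where
  "V_simple n K = {(V, l). V \<in> carrier_mat n K \<and> l \<in> carrier_vec K \<and>
     (\<forall>i j. i < j \<and> j < K \<longrightarrow> l $ i > l $ j)}"

definition permutation_matrices :: "nat \<Rightarrow> real mat set" where
  "permutation_matrices n =
     {mat n n (\<lambda>(i, j). if p i = j then 1 else 0) | p. p permutes {..<n}}"

definition sign_matrices :: "nat \<Rightarrow> real mat set" where
  "sign_matrices K = {mat_diag K s | s. \<forall>k<K. s k \<in> {-1, 1}}"

definition isomorphic_pairs ::
    "nat \<Rightarrow> nat \<Rightarrow> real mat \<times> real vec \<Rightarrow> real mat \<times> real vec \<Rightarrow> bool" where
  "isomorphic_pairs n K = (\<lambda>(V, l) (U, e). l = e \<and>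
     (\<exists>P \<in> permutation_matrices n. \<exists>S \<in> sign_matrices K. U = P * V * S))"

text \<open>Elementwise product of two vectors, intended for vectors of equal dimension.\<close>

definition hadamard :: "real vec \<Rightarrow> real vec \<Rightarrow> real vec" (infixl "\<odot>\<^sub>v" 70) where
  "v \<odot>\<^sub>v w = vec (dim_vec v) (\<lambda>k. v $ k * w $ k)"

text \<open>Hidden features take values in \<^typ>\<open>real vec\<close>, the union of all the spaces
  \<open>\<real>\<^sup>d\<close>. No constraint is put on the dimension of the values of an update
  function, so the feature dimension may vary between iterations (or even between arguments).\<close>

type_synonym epnn_update =
  "real vec \<Rightarrow> real vec \<Rightarrow> (real vec \<times> real vec) multiset \<Rightarrow> real vec"

primrec epnn_feature ::
    "(nat \<Rightarrow> epnn_update) \<Rightarrow> real mat \<Rightarrow> real vec \<Rightarrow> nat \<Rightarrow> nat \<Rightarrow> real vec" where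
  "epnn_feature upd V l 0 = (\<lambda>i. row V i \<odot>\<^sub>v row V i)"
| "epnn_feature upd V l (Suc t) = (\<lambda>i. upd t (epnn_feature upd V l t i) l
     {# (epnn_feature upd V l t j, row V i \<odot>\<^sub>v row V j). j \<in># mset_set {..<dim_row V} #})"

definition epnn ::
    "nat \<Rightarrow> (nat \<Rightarrow> epnn_update) \<Rightarrow> (real vec multiset \<Rightarrow> real vec)
      \<Rightarrow> real mat \<times> real vec \<Rightarrow> real vec" where
  "epnn T upd readout =
     (\<lambda>(V, l). readout {# epnn_feature upd V l T i. i \<in># mset_set {..<dim_row V} #})"

text \<open>The members are total functions; only their values on \<^const>\<open>V_simple\<close> matter. The
  output dimension \<open>m\<close> is fixed per function.\<close>

definition F_EPNN :: "(real mat \<times> real vec \<Rightarrow> real vec) set" where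
  "F_EPNN = {epnn T upd readout | T upd readout. \<exists>m. range readout \<subseteq> carrier_vec m}"

definition sparse_domain :: "nat \<Rightarrow> nat \<Rightarrow> (real mat \<times> real vec) set" where
  "sparse_domain n K = {(V, l) \<in> V_simple n K.
     card {(i, j). i < n \<and> j < K \<and> V $$ (i, j) = 0} < n}"

definition complete_on ::
    "nat \<Rightarrow> nat \<Rightarrow> (real mat \<times> real vec \<Rightarrow> real vec) set \<Rightarrow> (real mat \<times> real vec) set \<Rightarrow> bool" where
  "complete_on n K F D \<longleftrightarrow> (\<forall>X \<in> D. \<forall>Y \<in> D.
     \<not> isomorphic_pairs n K X Y \<longrightarrow> (\<exists>f \<in> F. f X \<noteq> f Y))"

end

theory Submission
  imports Defs
begin

text \<open>Fewer than \<open>n\<close> zeros among \<open>n\<close> rows leave some row \<open>i\<close> of \<open>V\<close> without zeros. Suppose a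
  row \<open>i'\<close> of \<open>U\<close> has the same feature after one iteration, for an injective update. Then the
  initial features give \<open>U\<^sub>i\<^sub>' = V\<^sub>i S\<close> for a sign matrix \<open>S\<close>, and the multisets
  \<open>{V\<^sub>i \<odot> V\<^sub>j}\<close> and \<open>{U\<^sub>i\<^sub>' \<odot> U\<^sub>j}\<close> agree. Since \<open>V\<^sub>i\<close> can be cancelled, \<open>U\<^sub>j = V\<^bsub>p j\<^esub> S\<close> for
  a permutation \<open>p\<close>. To separate two given pairs, the update need not be injective: it is
  enough that it recognises the feature of the row \<open>i\<close>.\<close>

lemma exists_row_without_zeros:
  assumes "card {(i, j). i < n \<and> j < K \<and> V $$ (i, j) = 0} < n"
  obtains i where "i < n" "\<And>k. k < K \<Longrightarrow> V $$ (i, k) \<noteq> 0"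
proof -
  let ?Z = "{(i, j). i < n \<and> j < K \<and> V $$ (i, j) = 0}"
  have fin: "finite ?Z"
    by (rule finite_subset[of _ "{..<n} \<times> {..<K}"]) auto
  have "\<not> {..<n} \<subseteq> fst ` ?Z"
  proof
    assume "{..<n} \<subseteq> fst ` ?Z"
    then have "n \<le> card (fst ` ?Z)"
      using card_mono[of "fst ` ?Z" "{..<n}"] fin by simp
    also have "\<dots> \<le> card ?Z"
      by (rule card_image_le[OF fin])
    finally show False
      using assms by simp
  qed
  then obtain i where "i < n" "i \<notin> fst ` ?Z"
    by auto
  then show thesis
    by (intro that[of i]) (auto simp: image_iff)
qed

text \<open>Row \<open>i\<close> of \<open>P * V\<close> is row \<open>p i\<close> of
  \<open>V\<close>, and the diagonal factor scales column \<open>k\<close> by \<open>s k\<close>.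
  This entrywise form lets the main argument avoid matrix products.\<close>

lemma isomorphic_pairs_iff:
  assumes "V \<in> carrier_mat n K" "U \<in> carrier_mat n K"
  shows "isomorphic_pairs n K (V, l) (U, e) \<longleftrightarrow> l = e \<and>
    (\<exists>p s. p permutes {..<n} \<and> (\<forall>k<K. s k \<in> {-1, 1}) \<and>
      (\<forall>i<n. \<forall>k<K. U $$ (i, k) = V $$ (p i, k) * s k))"
proof -
  let ?P = "\<lambda>p. mat n n (\<lambda>(i, j). if p i = j then 1 else 0) :: real mat"
  have entry: "(?P p * V * mat_diag K s) $$ (i, k) = V $$ (p i, k) * s k"
    if p: "p permutes {..<n}" and ik: "i < n" "k < K" for p s i k
  proof -
    have pi: "p i < n"
      using permutes_in_image[OF p, of i] ik by simp
    have PV: "?P p * V \<in> carrier_mat n K"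
      using assms by (intro mult_carrier_mat) auto
    \<comment> \<open>Row \<open>i\<close> of the permutation matrix is the unit vector at
      \<open>p i\<close>, so one term survives; \<open>pi\<close> puts it in the range of
      summation.\<close>
    have "(?P p * V) $$ (i, k) = (\<Sum>j\<in>{0..<n}. (if p i = j then 1 else 0) * V $$ (j, k))"
      using assms ik by (auto simp: scalar_prod_def intro!: sum.cong)
    also have "\<dots> = (\<Sum>j\<in>{0..<n}. if p i = j then V $$ (j, k) else 0)"
      by (intro sum.cong) auto
    finally show ?thesis
      using pi ik by (simp add: mat_diag_mult_right[OF PV])
  qed
  have "U = ?P p * V * mat_diag K s \<longleftrightarrow>
      (\<forall>i<n. \<forall>k<K. U $$ (i, k) = V $$ (p i, k) * s k)"
    if p: "p permutes {..<n}" for p s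
  proof -
    have "?P p * V * mat_diag K s \<in> carrier_mat n K"
      using assms by (intro mult_carrier_mat mat_diag_dim) auto
    moreover have "U = A \<longleftrightarrow> (\<forall>i<n. \<forall>k<K. U $$ (i, k) = A $$ (i, k))"
      if "A \<in> carrier_mat n K" for A
      using assms(2) that by (auto intro!: eq_matI)
    ultimately show ?thesis
      using entry[OF p] by metis
  qed
  then show ?thesis
    unfolding isomorphic_pairs_def permutation_matrices_def sign_matrices_def by auto metis
qed

lemma row_hadamard_eq_iff:
  assumes "V \<in> carrier_mat n K" "U \<in> carrier_mat m K" "i < n" "i' < n" "j < m" "j' < m"
  shows "row V i \<odot>\<^sub>v row V i' = row U j \<odot>\<^sub>v row U j' \<longleftrightarrow>
    (\<forall>k<K. V $$ (i, k) * V $$ (i', k) = U $$ (j, k) * U $$ (j', k))"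
  using assms by (auto simp: hadamard_def vec_eq_iff)

lemma isomorphic_if_nonzero_row_matches:
  assumes V: "V \<in> carrier_mat n K" and U: "U \<in> carrier_mat n K"
    and i: "i < n" and nz: "\<And>k. k < K \<Longrightarrow> V $$ (i, k) \<noteq> 0" and i': "i' < n"
    and square: "row U i' \<odot>\<^sub>v row U i' = row V i \<odot>\<^sub>v row V i"
    and products: "{# row U i' \<odot>\<^sub>v row U j. j \<in># mset_set {..<n} #} =
      {# row V i \<odot>\<^sub>v row V j. j \<in># mset_set {..<n} #}"
  shows "isomorphic_pairs n K (V, l) (U, l)"
proof -
  \<comment> \<open>Whole vectors are matched, so a single \<open>p\<close> serves all
    columns.\<close>
  obtain p where p: "p permutes {..<n}"
    and eq: "\<And>j. j < n \<Longrightarrow> row U i' \<odot>\<^sub>v row U j = row V i \<odot>\<^sub>v row V (p j)"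
    using image_mset_eq_implies_permutes[OF finite_lessThan products] by (metis lessThan_iff)
  \<comment> \<open>The quotient is the only possible sign for column \<open>k\<close>; the equal
    squares of the two rows force it to be 1 or -1.\<close>
  define s where "s k = U $$ (i', k) / V $$ (i, k)" for k
  have s: "U $$ (i', k) = s k * V $$ (i, k)" "s k \<in> {-1, 1}" if k: "k < K" for k
  proof -
    show 1: "U $$ (i', k) = s k * V $$ (i, k)"
      using nz[OF k] by (simp add: s_def)
    have "U $$ (i', k) * U $$ (i', k) = V $$ (i, k) * V $$ (i, k)"
      using square k by (simp add: row_hadamard_eq_iff[OF U V i' i' i i])
    then have "(s k * s k) * (V $$ (i, k) * V $$ (i, k)) = 1 * (V $$ (i, k) * V $$ (i, k))"
      by (simp add: 1 mult_ac)
    then have "s k * s k = 1"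
      using nz[OF k] by (metis mult_cancel_right mult_eq_0_iff)
    then show "s k \<in> {-1, 1}"
      by (auto simp: square_eq_1_iff)
  qed
  have "U $$ (j, k) = V $$ (p j, k) * s k" if j: "j < n" and k: "k < K" for j k
  proof -
    have pj: "p j < n"
      using permutes_in_image[OF p, of j] j by simp
    have "U $$ (i', k) * U $$ (j, k) = V $$ (i, k) * V $$ (p j, k)"
      using eq[OF j] k by (simp add: row_hadamard_eq_iff[OF U V i' j i pj])
    then have "s k * U $$ (j, k) = V $$ (p j, k)"
      using nz[OF k] by (simp add: s(1)[OF k])
    \<comment> \<open>A sign is its own inverse, so \<open>s k\<close> can change sides.\<close>
    then show ?thesis
      using s(2)[OF k] by auto
  qed
  then show ?thesis
    unfolding isomorphic_pairs_iff[OF V U] using p s(2) by blast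
qed

text \<open>One iteration suffices: by \<open>differs\<close>, no row of \<open>U\<close> feeds the
  update the same three arguments as row \<open>i\<close> of \<open>V\<close>.\<close>

lemma F_EPNN_separates:
  assumes i: "i < n" and V: "dim_row V = n" and U: "dim_row U = n"
    and differs: "\<And>j. j < n \<Longrightarrow> l = e \<Longrightarrow>
      row U j \<odot>\<^sub>v row U j = row V i \<odot>\<^sub>v row V i \<Longrightarrow>
      {# (row U m \<odot>\<^sub>v row U m, row U j \<odot>\<^sub>v row U m). m \<in># mset_set {..<n} #} =
      {# (row V m \<odot>\<^sub>v row V m, row V i \<odot>\<^sub>v row V m). m \<in># mset_set {..<n} #} \<Longrightarrow> False"
  shows "\<exists>f \<in> F_EPNN. f (V, l) \<noteq> f (U, e)"
proof -
  let ?B = "{# (row V m \<odot>\<^sub>v row V m, row V i \<odot>\<^sub>v row V m). m \<in># mset_set {..<n} #}"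
  let ?zero = "vec 1 (\<lambda>_. 0) :: real vec" and ?one = "vec 1 (\<lambda>_. 1) :: real vec"
  \<comment> \<open>Updates are arbitrary functions, so \<open>V\<close>, \<open>l\<close> and
    \<open>i\<close> may be built in as constants: the update is the indicator of the arguments seen
    at row \<open>i\<close>, and the readout asks whether any row raised this flag.\<close>
  define upd :: "nat \<Rightarrow> epnn_update" where
    "upd t h l' M = (if h = row V i \<odot>\<^sub>v row V i \<and> l' = l \<and> M = ?B then ?one else ?zero)"
    for t h l' M
  define readout :: "real vec multiset \<Rightarrow> real vec" where
    "readout M = (if ?one \<in># M then ?one else ?zero)" for M
  have neq: "?zero \<noteq> ?one"
    by (auto simp: vec_eq_iff)
  have "epnn 1 upd readout (V, l) = ?one"
    using i V by (auto simp: epnn_def upd_def readout_def)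
  moreover have "epnn 1 upd readout (U, e) = ?zero"
    using U neq differs by (auto simp: epnn_def upd_def readout_def split: if_splits)
  moreover have "epnn 1 upd readout \<in> F_EPNN"
  proof -
    have "range readout \<subseteq> carrier_vec 1"
      by (auto simp: readout_def)
    then show ?thesis
      unfolding F_EPNN_def by blast
  qed
  ultimately show ?thesis
    using neq by metis
qed

theorem theorem3:
  fixes n K :: nat
  assumes "K \<le> n"
  shows "complete_on n K F_EPNN (sparse_domain n K)"
  unfolding complete_on_def
proof (intro ballI impI)
  fix X Y
  assume X: "X \<in> sparse_domain n K" and Y: "Y \<in> sparse_domain n K"
    and non_iso: "\<not> isomorphic_pairs n K X Y"
  obtain V l where Xeq: "X = (V, l)" by (cases X)
  obtain U e where Yeq: "Y = (U, e)" by (cases Y)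
  have V: "V \<in> carrier_mat n K" and U: "U \<in> carrier_mat n K"
    and zeros: "card {(i, j). i < n \<and> j < K \<and> V $$ (i, j) = 0} < n"
    using X Y by (auto simp: Xeq Yeq sparse_domain_def V_simple_def)
  obtain i where i: "i < n" and nz: "\<And>k. k < K \<Longrightarrow> V $$ (i, k) \<noteq> 0"
    using exists_row_without_zeros[OF zeros] by blast
  show "\<exists>f \<in> F_EPNN. f X \<noteq> f Y"
    unfolding Xeq Yeq
  proof (rule F_EPNN_separates[OF i])
    show "dim_row V = n" "dim_row U = n"
      using V U by auto
    fix j
    assume j: "j < n" and "l = e"
      and square: "row U j \<odot>\<^sub>v row U j = row V i \<odot>\<^sub>v row V i"
      and messages: "{# (row U m \<odot>\<^sub>v row U m, row U j \<odot>\<^sub>v row U m). m \<in># mset_set {..<n} #} =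
        {# (row V m \<odot>\<^sub>v row V m, row V i \<odot>\<^sub>v row V m). m \<in># mset_set {..<n} #}"
    \<comment> \<open>Projecting each message to its second component keeps just the products with
      the reference row.\<close>
    have "{# row U j \<odot>\<^sub>v row U m. m \<in># mset_set {..<n} #} =
        {# row V i \<odot>\<^sub>v row V m. m \<in># mset_set {..<n} #}"
      using arg_cong[OF messages, of "image_mset snd"]
      by (simp add: image_mset.compositionality o_def)
    from isomorphic_if_nonzero_row_matches[OF V U i nz j square this]
    show False
      using non_iso \<open>l = e\<close> by (simp add: Xeq Yeq)
  qed
qed

end
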